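(* Let $M\in\mathbb{R}^{n\times n}$ and $q\in\mathbb{R}^n$. Given any complementary pair $(x^0,s^0)\in\mathbb{R}^n\times\mathbb{R}^n$ with $x^0\ge 0$, $s^0\ge 0$ (that is, $(x^0)^Ts^0=0$), the following inverse problem ILCP(b) of the linear complementarity problem with data $(M,q)$, $$\min\ \|M-M'\|_f^2+\|q-q'\|^2\quad\text{s.t.}\quad s^0=M'x^0+q',\quad (x^0)^Ts^0=0$$ in the variables $M'\in\mathbb{R}^{n\times n}$, $q'\in\mathbb{R}^n$, can be solved in polynomial time.
   Context: The linear complementarity problem (LCP) with data $(M,q)$ is to find $(x,s)\in\mathbb{R}^n\times\mathbb{R}^n$ with $s=Mx+q$, $x\ge 0$, $s\ge 0$, $x^Ts=0$; equivalently, formulated as an optimization problem, to minimize $x^Ts$ subject to $s=Mx+q$, $x,s\ge 0$. It is called monotone if $M$ (not necessarily symmetric) is positive semidefinite and non-monotone otherwise; $M$ is not assumed positive semidefinite here. $\|B\|_f=\sqrt{\sum_{i,j}B_{ij}^2}$ is the Frobenius norm and $\|\cdot\|$ is the Euclidean norm. Vector inequalities are componentwise. ILCP(b) is the inverse problem in the case where a complementary pair $(x^0,s^0)\ge 0$ is given (the case of interest being a non-feasible pair, $s^0\ne Mx^0+q$): find $M'$, $q'$ closest to $M$, $q$ such that $(x^0,s^0)$ is an optimal solution of the LCP with data $(M',q')$. The input of the problem is $(M,q,x^0,s^0)$. *)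

theory Defs
  imports
    Complex_Main
    "HOL-Library.Log_Nat"
    "HOL-Computational_Algebra.Polynomial"
    "Jordan_Normal_Form.Matrix"
begin

section \<open>Random access machines over the real numbers\<close>

text \<open>
  A real RAM has index registers, which hold natural numbers and support only addition and
  truncated subtraction (no multiplication, and no conversion from real numbers), and a memory of
  real numbers, which is addressed through index registers and supports the field operations and
  comparisons. The numbers occurring in an instruction name index registers; the exceptions are
  the jump targets, which are absolute positions in the program, and the constants of
  \<open>IConst\<close> and \<open>RConst\<close>. Only integer constants are allowed, so rational memory contents stay
  rational.
\<close>

datatype arith_op = Plus | Minus | Times | Divide

datatype instr =
    IConst nat nat
  | IAdd nat nat nat
  | ISub nat nat nat
  | RConst nat int
  | RArith arith_op nat nat nat
  | Jump nat
  | IJump_less nat nat nat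
  | RJump_less nat nat nat

record state =
  pc :: nat
  ix :: "nat \<Rightarrow> nat"
  mem :: "nat \<Rightarrow> real"

text \<open>Division by zero yields zero, as everywhere in HOL.\<close>

fun arith :: "arith_op \<Rightarrow> real \<Rightarrow> real \<Rightarrow> real" where
  "arith Plus x y = x + y"
| "arith Minus x y = x - y"
| "arith Times x y = x * y"
| "arith Divide x y = x / y"

fun step :: "instr \<Rightarrow> state \<Rightarrow> state" where
  "step (IConst d k) c = c\<lparr>pc := Suc (pc c), ix := (ix c)(d := k)\<rparr>"
| "step (IAdd d a b) c = c\<lparr>pc := Suc (pc c), ix := (ix c)(d := ix c a + ix c b)\<rparr>"
| "step (ISub d a b) c = c\<lparr>pc := Suc (pc c), ix := (ix c)(d := ix c a - ix c b)\<rparr>"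
| "step (RConst d k) c = c\<lparr>pc := Suc (pc c), mem := (mem c)(ix c d := of_int k)\<rparr>"
| "step (RArith f d a b) c =
     c\<lparr>pc := Suc (pc c),
       mem := (mem c)(ix c d := arith f (mem c (ix c a)) (mem c (ix c b)))\<rparr>"
| "step (Jump l) c = c\<lparr>pc := l\<rparr>"
| "step (IJump_less a b l) c = c\<lparr>pc := (if ix c a < ix c b then l else Suc (pc c))\<rparr>"
| "step (RJump_less a b l) c =
     c\<lparr>pc := (if mem c (ix c a) < mem c (ix c b) then l else Suc (pc c))\<rparr>"

text \<open>
  The number of bits of a natural number, where zero also occupies a bit, and of a rational
  number given by numerator (with sign) and denominator in lowest terms. \<open>bit_size\<close> is
  meaningful on rational arguments only.
\<close>

definition nat_size :: "nat \<Rightarrow> nat" where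
  "nat_size k = Suc (floorlog 2 k)"

definition bit_size :: "real \<Rightarrow> nat" where
  "bit_size x = (case quotient_of (the_inv real_of_rat x) of
     (a, b) \<Rightarrow> nat_size (nat \<bar>a\<bar>) + nat_size (nat b))"

text \<open>
  The cost of an instruction is one plus the sizes of all its operands and addresses (as in the
  logarithmic cost criterion), where \<open>w\<close> measures real numbers: with \<open>w = bit_size\<close> this is the
  logarithmic cost, polynomially equivalent to Turing machine time on rational data; with
  \<open>w = (\<lambda>_. 1)\<close> every real number has size one, every arithmetic operation on real numbers counts
  as one operation, and this is the real-number (Blum-Shub-Smale) model, where only the
  bookkeeping on indices is still measured in bits.
\<close>

fun cost :: "(real \<Rightarrow> nat) \<Rightarrow> instr \<Rightarrow> state \<Rightarrow> nat" where
  "cost w (IConst d k) c = 1 + nat_size k"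
| "cost w (IAdd d a b) c = 1 + nat_size (ix c a) + nat_size (ix c b)"
| "cost w (ISub d a b) c = 1 + nat_size (ix c a) + nat_size (ix c b)"
| "cost w (RConst d k) c = 1 + nat_size (ix c d) + w (of_int k)"
| "cost w (RArith f d a b) c =
     1 + nat_size (ix c d) + nat_size (ix c a) + nat_size (ix c b)
       + w (mem c (ix c a)) + w (mem c (ix c b))"
| "cost w (Jump l) c = 1"
| "cost w (IJump_less a b l) c = 1 + nat_size (ix c a) + nat_size (ix c b)"
| "cost w (RJump_less a b l) c =
     1 + nat_size (ix c a) + nat_size (ix c b) + w (mem c (ix c a)) + w (mem c (ix c b))"

text \<open>
  \<open>exec w P c t c'\<close>: started in \<open>c\<close>, the program \<open>P\<close> halts in \<open>c'\<close> after total cost \<open>t\<close>.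
  A program halts by leaving its code.
\<close>

inductive exec :: "(real \<Rightarrow> nat) \<Rightarrow> instr list \<Rightarrow> state \<Rightarrow> nat \<Rightarrow> state \<Rightarrow> bool"
  for w :: "real \<Rightarrow> nat" and P :: "instr list" where
  halt: "length P \<le> pc c \<Longrightarrow> exec w P c 0 c"
| step: "pc c < length P \<Longrightarrow> exec w P (step (P ! pc c) c) t c'
          \<Longrightarrow> exec w P c (cost w (P ! pc c) c + t) c'"


section \<open>Polynomial-time solvability\<close>

text \<open>
  An input is a dimension, placed in index register 0, and a list of real numbers, placed at the
  beginning of the memory. All other registers and memory cells are initially zero.
\<close>

fun init_state :: "nat \<times> real list \<Rightarrow> state" where
  "init_state (n, xs) =
     \<lparr>pc = 0, ix = (\<lambda>_. 0)(0 := n), mem = (\<lambda>i. if i < length xs then xs ! i else 0)\<rparr>"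

fun input_size :: "(real \<Rightarrow> nat) \<Rightarrow> nat \<times> real list \<Rightarrow> nat" where
  "input_size w (n, xs) = nat_size n + (\<Sum>x\<leftarrow>xs. w x)"

text \<open>
  One program has to work for all instances in \<open>I\<close>, hence for all dimensions. The output is read
  off from the beginning of the memory.
\<close>

definition poly_time_solvable ::
  "(real \<Rightarrow> nat) \<Rightarrow> 'i set \<Rightarrow> ('i \<Rightarrow> 'o \<Rightarrow> bool)
     \<Rightarrow> ('i \<Rightarrow> nat \<times> real list) \<Rightarrow> ('o \<Rightarrow> real list) \<Rightarrow> bool" where
  "poly_time_solvable w I is_solution enc_in enc_out \<longleftrightarrow>
     (\<exists>(P :: instr list) (p :: nat poly). \<forall>i \<in> I. \<exists>t c' out.
        exec w P (init_state (enc_in i)) t c' \<and>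
        t \<le> poly p (input_size w (enc_in i)) \<and>
        is_solution i out \<and>
        (\<forall>k < length (enc_out out). mem c' k = enc_out out ! k))"


section \<open>The inverse linear complementarity problem\<close>

definition frobenius_norm :: "real mat \<Rightarrow> real" where
  "frobenius_norm B = sqrt (\<Sum>i<dim_row B. \<Sum>j<dim_col B. (B $$ (i, j))\<^sup>2)"

definition euclidean_norm :: "real vec \<Rightarrow> real" where
  "euclidean_norm v = sqrt (v \<bullet> v)"

type_synonym ilcp_instance = "real mat \<times> real vec \<times> real vec \<times> real vec"

definition ilcp_b_instances :: "ilcp_instance set" where
  "ilcp_b_instances = {(M, q, x0, s0). \<exists>n.
     M \<in> carrier_mat n n \<and> q \<in> carrier_vec n \<and> x0 \<in> carrier_vec n \<and> s0 \<in> carrier_vec n \<and>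
     0\<^sub>v n \<le> x0 \<and> 0\<^sub>v n \<le> s0 \<and> x0 \<bullet> s0 = 0}"

fun ilcp_b_objective :: "ilcp_instance \<Rightarrow> real mat \<times> real vec \<Rightarrow> real" where
  "ilcp_b_objective (M, q, x0, s0) (M', q') =
     (frobenius_norm (M - M'))\<^sup>2 + (euclidean_norm (q - q'))\<^sup>2"

fun ilcp_b_feasible :: "ilcp_instance \<Rightarrow> real mat \<times> real vec \<Rightarrow> bool" where
  "ilcp_b_feasible (M, q, x0, s0) (M', q') \<longleftrightarrow>
     M' \<in> carrier_mat (dim_vec q) (dim_vec q) \<and> q' \<in> carrier_vec (dim_vec q) \<and>
     s0 = M' *\<^sub>v x0 + q' \<and> x0 \<bullet> s0 = 0"

definition ilcp_b_optimal :: "ilcp_instance \<Rightarrow> real mat \<times> real vec \<Rightarrow> bool" where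
  "ilcp_b_optimal I = is_arg_min (ilcp_b_objective I) (ilcp_b_feasible I)"

text \<open>Matrices are stored row by row.\<close>

fun ilcp_b_input :: "ilcp_instance \<Rightarrow> nat \<times> real list" where
  "ilcp_b_input (M, q, x0, s0) =
     (dim_vec q,
      concat (mat_to_list M) @ list_of_vec q @ list_of_vec x0 @ list_of_vec s0)"

fun ilcp_b_output :: "real mat \<times> real vec \<Rightarrow> real list" where
  "ilcp_b_output (M', q') = concat (mat_to_list M') @ list_of_vec q'"

definition rational_ilcp_b_instances :: "ilcp_instance set" where
  "rational_ilcp_b_instances = {I \<in> ilcp_b_instances. set (snd (ilcp_b_input I)) \<subseteq> \<rat>}"

end

theory Submission
  imports Defs
begin

text \<open>
  The constraints decouple into one hyperplane \<open>{(a, b). a \<bullet> x0 + b = s0\<^sub>i}\<close> for each row \<open>(a, b)\<close>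
  of \<open>(M', q')\<close>, so the optimum is the orthogonal projection of the rows of \<open>(M, q)\<close>: with
  \<open>\<rho> = (s0 - q - M x0) / (1 + x0 \<bullet> x0)\<close> it is \<open>M' = M + \<rho> x0\<^sup>T\<close>, \<open>q' = q + \<rho>\<close>. A program with
  quadratically many arithmetic operations computes it. For rational data, define the height of a
  fraction in lowest terms as the sum of the absolute values of its numerator and denominator. The
  height is submultiplicative under all four arithmetic operations, so the logarithm of the height
  of every intermediate result is bounded by a quadratic polynomial in the input size.
\<close>

section \<open>Straight-line code and loops with cost bounds\<close>

text \<open>The linear bound is affordable because addresses stay quadratic in the dimension, like
  the number of input entries.\<close>

lemma nat_size_le: "nat_size k \<le> k + 1"
proof -
  have "floorlog 2 k \<le> k"
    by (rule floorlog_leI) (auto simp: of_nat_less_two_power)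
  then show ?thesis by (simp add: nat_size_def)
qed

text \<open>
  \<open>B x k\<close> bounds the size of \<open>x\<close> by \<open>k\<close> in a way that is additive under arithmetic. It holds
  vacuously in the unit cost model; in the bit model it says that the absolute values of numerator
  and denominator add up to at most \<open>2^k\<close>.
\<close>

locale real_size =
  fixes w :: "real \<Rightarrow> nat" and B :: "real \<Rightarrow> nat \<Rightarrow> bool"
  assumes B_mono: "B x k \<Longrightarrow> k \<le> l \<Longrightarrow> B x l"
    and B_arith: "B x k \<Longrightarrow> B y l \<Longrightarrow> B (arith f x y) (k + l)"
    and B_zero: "B 0 0"
    and B_one: "B 1 1"
    and w_le: "B x k \<Longrightarrow> w x \<le> 2 * k + 4"
    and w_pos: "0 < w x"
begin

lemma B_add: "B x k \<Longrightarrow> B y l \<Longrightarrow> k + l \<le> r \<Longrightarrow> B (x + y) r"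
  using B_mono B_arith[of x k y l Plus] by simp

lemma B_diff: "B x k \<Longrightarrow> B y l \<Longrightarrow> k + l \<le> r \<Longrightarrow> B (x - y) r"
  using B_mono B_arith[of x k y l Minus] by simp

lemma B_mult: "B x k \<Longrightarrow> B y l \<Longrightarrow> k + l \<le> r \<Longrightarrow> B (x * y) r"
  using B_mono B_arith[of x k y l Times] by simp

lemma B_divide: "B x k \<Longrightarrow> B y l \<Longrightarrow> k + l \<le> r \<Longrightarrow> B (x / y) r"
  using B_mono B_arith[of x k y l Divide] by simp

lemma B_sum: "(\<And>j. j < k \<Longrightarrow> B (f j) l) \<Longrightarrow> B (\<Sum>j<k. f j) (k * l)"
proof (induction k)
  case (Suc k)
  then show ?case by (auto intro!: B_add[of _ "k * l" _ l])
qed (simp add: B_zero)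

end

type_synonym assn = "(nat \<Rightarrow> nat) \<Rightarrow> (nat \<Rightarrow> real) \<Rightarrow> bool"

text \<open>
  Jump targets are absolute, so a code fragment is a function of the position at which it is placed.
\<close>

type_synonym code = "nat \<Rightarrow> instr list"

definition seq :: "code \<Rightarrow> code \<Rightarrow> code" (infixr \<open>;;\<close> 60) where
  "(cd ;; cd') l = cd l @ cd' (l + length (cd l))"

text \<open>A conditional jump is taken only if the comparison holds, so the test skips over an exit
  jump. These two instructions and the backward jump account for the offsets 2 and 3.\<close>

definition while_less :: "nat \<Rightarrow> nat \<Rightarrow> code \<Rightarrow> code" where
  "while_less a b cd l =
     [IJump_less a b (l + 2), Jump (l + 3 + length (cd (l + 2)))] @ cd (l + 2) @ [Jump l]"

section \<open>Runs with uniformly bounded registers and memory contents\<close>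

locale bounded_ram = real_size +
  fixes A K :: nat
begin

text \<open>\<open>A\<close> limits the index registers and \<open>K\<close> the size exponents in
  memory. An instruction involves at most three addresses and two real operands.\<close>

definition C :: nat where
  "C = 1 + 3 * (A + 1) + 2 * (2 * K + 4)"

definition good :: assn where
  "good i m \<longleftrightarrow> (\<forall>r. i r \<le> A) \<and> (\<forall>a. B (m a) K)"

text \<open>
  The continuation style lets costs compose without a separate notion of partial execution.
\<close>

definition runs :: "instr list \<Rightarrow> state \<Rightarrow> nat \<Rightarrow> state \<Rightarrow> bool" where
  "runs P c t c' \<longleftrightarrow> (\<forall>u d. exec w P c' u d \<longrightarrow> (\<exists>t'\<le>t. exec w P c (t' + u) d))"

lemma runs_refl: "runs P c t c"
  unfolding runs_def by (metis add_0 le0)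

lemma runs_trans:
  assumes "runs P c t c'" "runs P c' t' c''" "t + t' \<le> r"
  shows "runs P c r c''"
  unfolding runs_def
proof (intro allI impI)
  fix u d
  assume "exec w P c'' u d"
  then obtain s where s: "s \<le> t'" "exec w P c' (s + u) d"
    using assms(2) unfolding runs_def by blast
  then obtain s' where "s' \<le> t" "exec w P c (s' + (s + u)) d"
    using assms(1) unfolding runs_def by blast
  then show "\<exists>t'\<le>r. exec w P c (t' + u) d"
    using s(1) assms(3) by (intro exI[of _ "s' + s"]) (simp add: add.assoc)
qed

lemma runs_step:
  assumes "l < length P" "P ! l = x" "step x \<lparr>pc = l, ix = i, mem = m\<rparr> = c"
    "cost w x \<lparr>pc = l, ix = i, mem = m\<rparr> \<le> s"
  shows "runs P \<lparr>pc = l, ix = i, mem = m\<rparr> s c"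
  unfolding runs_def
proof (intro allI impI)
  fix u d
  assume "exec w P c u d"
  then have "exec w P \<lparr>pc = l, ix = i, mem = m\<rparr> (cost w x \<lparr>pc = l, ix = i, mem = m\<rparr> + u) d"
    using exec.step[of "\<lparr>pc = l, ix = i, mem = m\<rparr>" P w u d] assms(1-3) by simp
  then show "\<exists>t'\<le>s. exec w P \<lparr>pc = l, ix = i, mem = m\<rparr> (t' + u) d"
    using assms(4) by blast
qed

text \<open>Total correctness with a cost bound, for a fragment at any place of any program, so that
  absolute jump targets do no harm. Preservation of \<open>good\<close> keeps the cost bound
  \<open>C\<close> valid.\<close>

definition triple :: "assn \<Rightarrow> code \<Rightarrow> nat \<Rightarrow> assn \<Rightarrow> bool" where
  "triple Q cd t R \<longleftrightarrow>
     (\<forall>ps qs P l i m. P = ps @ cd l @ qs \<longrightarrow> l = length ps \<longrightarrow> good i m \<longrightarrow> Q i m \<longrightarrow>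
       (\<exists>i' m'. good i' m' \<and> R i' m' \<and>
          runs P \<lparr>pc = l, ix = i, mem = m\<rparr> t \<lparr>pc = l + length (cd l), ix = i', mem = m'\<rparr>))"

lemma tripleI:
  assumes "\<And>ps qs P l i m. P = ps @ cd l @ qs \<Longrightarrow> l = length ps \<Longrightarrow> good i m \<Longrightarrow> Q i m \<Longrightarrow>
     \<exists>i' m'. good i' m' \<and> R i' m' \<and>
       runs P \<lparr>pc = l, ix = i, mem = m\<rparr> t \<lparr>pc = l + length (cd l), ix = i', mem = m'\<rparr>"
  shows "triple Q cd t R"
  using assms unfolding triple_def by blast

lemma tripleE:
  assumes "triple Q cd t R" "P = ps @ cd l @ qs" "l = length ps" "good i m" "Q i m"
  obtains i' m' where "good i' m'" "R i' m'"
    "runs P \<lparr>pc = l, ix = i, mem = m\<rparr> t \<lparr>pc = l + length (cd l), ix = i', mem = m'\<rparr>"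
  using assms unfolding triple_def by blast

lemma triple_weaken:
  assumes "triple Q cd t R" "\<And>i m. Q' i m \<Longrightarrow> Q i m" "\<And>i m. R i m \<Longrightarrow> R' i m" "t \<le> t'"
  shows "triple Q' cd t' R'"
proof (rule tripleI)
  fix ps qs P l i m
  assume P: "P = ps @ cd l @ qs" "l = length ps" "good i m" "Q' i m"
  obtain i' m' where 1: "good i' m'" "R i' m'"
    "runs P \<lparr>pc = l, ix = i, mem = m\<rparr> t \<lparr>pc = l + length (cd l), ix = i', mem = m'\<rparr>"
    by (rule tripleE[OF assms(1), OF P(1-3) assms(2)[OF P(4)]])
  show "\<exists>i' m'. good i' m' \<and> R' i' m' \<and>
      runs P \<lparr>pc = l, ix = i, mem = m\<rparr> t' \<lparr>pc = l + length (cd l), ix = i', mem = m'\<rparr>"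
    using 1(1) assms(3)[OF 1(2)] runs_trans[OF 1(3) runs_refl[of _ _ 0]] assms(4) by auto
qed

lemma triple_seq:
  assumes "triple Q cd t R" "triple R cd' t' R'"
  shows "triple Q (cd ;; cd') (t + t') R'"
proof (rule tripleI)
  fix ps qs P l i m
  let ?l = "l + length (cd l)"
  assume P: "P = ps @ (cd ;; cd') l @ qs" "l = length ps" "good i m" "Q i m"
  have P1: "P = ps @ cd l @ (cd' ?l @ qs)" and P2: "P = (ps @ cd l) @ cd' ?l @ qs"
    and l: "?l = length (ps @ cd l)" "?l + length (cd' ?l) = l + length ((cd ;; cd') l)"
    using P by (auto simp: seq_def)
  obtain i1 m1 where 1: "good i1 m1" "R i1 m1"
    "runs P \<lparr>pc = l, ix = i, mem = m\<rparr> t \<lparr>pc = ?l, ix = i1, mem = m1\<rparr>"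
    by (rule tripleE[OF assms(1), OF P1 P(2-4)])
  obtain i2 m2 where 2: "good i2 m2" "R' i2 m2"
    "runs P \<lparr>pc = ?l, ix = i1, mem = m1\<rparr> t' \<lparr>pc = ?l + length (cd' ?l), ix = i2, mem = m2\<rparr>"
    by (rule tripleE[OF assms(2), OF P2 l(1) 1(1,2)])
  show "\<exists>i' m'. good i' m' \<and> R' i' m' \<and>
      runs P \<lparr>pc = l, ix = i, mem = m\<rparr> (t + t')
        \<lparr>pc = l + length ((cd ;; cd') l), ix = i', mem = m'\<rparr>"
    using 2(1,2) runs_trans[OF 1(3) 2(3) order.refl] unfolding l(2) by blast
qed

lemma good_size:
  assumes "good i m"
  shows "nat_size (i r) \<le> A + 1" "w (m a) \<le> 2 * K + 4"
  using assms nat_size_le[of "i r"] w_le[of "m a" K] unfolding good_def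
  by (auto intro: order_trans)

text \<open>Besides the effect, every written value must respect its bound; this is what
  re-establishes \<open>good\<close>. Jumps are left to the loop rule.\<close>

fun wp :: "instr list \<Rightarrow> assn \<Rightarrow> assn" where
  "wp [] R i m \<longleftrightarrow> R i m"
| "wp (IConst d k # is) R i m \<longleftrightarrow> k \<le> A \<and> wp is R (i(d := k)) m"
| "wp (IAdd d a b # is) R i m \<longleftrightarrow> i a + i b \<le> A \<and> wp is R (i(d := i a + i b)) m"
| "wp (RConst d k # is) R i m \<longleftrightarrow> B (of_int k) K \<and> wp is R i (m(i d := of_int k))"
| "wp (RArith f d a b # is) R i m \<longleftrightarrow>
     B (arith f (m (i a)) (m (i b))) K \<and>
     wp is R i (m(i d := arith f (m (i a)) (m (i b))))"
| "wp (_ # is) R i m \<longleftrightarrow> False"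

lemma wp_step:
  assumes "wp (x # xs) R i m" "good i m"
  obtains i' m' where
    "step x \<lparr>pc = l, ix = i, mem = m\<rparr> = \<lparr>pc = Suc l, ix = i', mem = m'\<rparr>"
    "cost w x \<lparr>pc = l, ix = i, mem = m\<rparr> \<le> C" "good i' m'" "wp xs R i' m'"
proof (cases x)
  case (IConst d k)
  with assms show ?thesis
    using nat_size_le[of k]
    by (intro that[of "i(d := k)" m]) (auto simp: C_def good_def)
next
  case (IAdd d a b)
  with assms show ?thesis
    using good_size(1)[OF assms(2), of a] good_size(1)[OF assms(2), of b]
    by (intro that[of "i(d := i a + i b)" m]) (auto simp: C_def good_def)
next
  case (RConst d k)
  with assms show ?thesis
    using good_size(1)[OF assms(2), of d] w_le[of "of_int k" K]
    by (intro that[of i "m(i d := of_int k)"]) (auto simp: C_def good_def)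
next
  case (RArith f d a b)
  with assms show ?thesis
    using good_size(1)[OF assms(2), of a] good_size(1)[OF assms(2), of b]
      good_size(1)[OF assms(2), of d] good_size(2)[OF assms(2), of "i a"]
      good_size(2)[OF assms(2), of "i b"]
    by (intro that[of i "m(i d := arith f (m (i a)) (m (i b)))"]) (auto simp: C_def good_def)
qed (use assms in auto)

lemma wp_runs:
  assumes "wp xs R i m" "good i m" "P = ps @ xs @ qs" "l = length ps"
  shows "\<exists>i' m'. good i' m' \<and> R i' m' \<and>
    runs P \<lparr>pc = l, ix = i, mem = m\<rparr> (length xs * C) \<lparr>pc = l + length xs, ix = i', mem = m'\<rparr>"
  using assms
proof (induction xs arbitrary: i m ps l)
  case Nil
  then show ?case by (auto intro: runs_refl)
next
  case (Cons x xs)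
  obtain i1 m1 where 1:
    "step x \<lparr>pc = l, ix = i, mem = m\<rparr> = \<lparr>pc = Suc l, ix = i1, mem = m1\<rparr>"
    "cost w x \<lparr>pc = l, ix = i, mem = m\<rparr> \<le> C" "good i1 m1" "wp xs R i1 m1"
    by (rule wp_step[OF Cons.prems(1,2)])
  have "P = (ps @ [x]) @ xs @ qs" "Suc l = length (ps @ [x])"
    using Cons.prems(3,4) by auto
  from Cons.IH[OF 1(4,3) this] obtain i2 m2 where 2: "good i2 m2" "R i2 m2"
    "runs P \<lparr>pc = Suc l, ix = i1, mem = m1\<rparr> (length xs * C)
       \<lparr>pc = Suc l + length xs, ix = i2, mem = m2\<rparr>"
    by blast
  have "runs P \<lparr>pc = l, ix = i, mem = m\<rparr> C \<lparr>pc = Suc l, ix = i1, mem = m1\<rparr>"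
    using Cons.prems(3,4) by (intro runs_step[OF _ _ 1(1,2)]) auto
  from runs_trans[OF this 2(3)] have "runs P \<lparr>pc = l, ix = i, mem = m\<rparr> (length (x # xs) * C)
       \<lparr>pc = l + length (x # xs), ix = i2, mem = m2\<rparr>"
    by simp
  with 2(1,2) show ?case by blast
qed

lemma triple_block:
  assumes "\<And>i m. good i m \<Longrightarrow> Q i m \<Longrightarrow> wp xs R i m"
  shows "triple Q (\<lambda>_. xs) (length xs * C) R"
  by (intro tripleI wp_runs assms)

text \<open>The number \<open>N\<close> of rounds is fixed in advance, and \<open>k\<close> counts
  the finished ones. A round pays for the body, the test and the backward jump; the final
  \<open>2 * C\<close> pays for the failing test and the exit jump.\<close>

lemma triple_while:
  assumes test: "\<And>k i m. k \<le> N \<Longrightarrow> I k i m \<Longrightarrow> i a < i b \<longleftrightarrow> k < N"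
    and body: "\<And>k. k < N \<Longrightarrow> triple (I k) cd t (I (Suc k))"
  shows "triple (I 0) (while_less a b cd) (N * (t + 2 * C) + 2 * C) (I N)"
proof (rule tripleI)
  fix ps qs P l i m
  \<comment> \<open>\<open>?s k\<close> is the budget that remains after \<open>k\<close> rounds,
    and \<open>?r\<close> is the position of the backward jump.\<close>
  let ?l = "l + length (while_less a b cd l)" and ?s = "\<lambda>k. (N - k) * (t + 2 * C) + 2 * C"
  let ?r = "l + 2 + length (cd (l + 2))"
  assume P: "P = ps @ while_less a b cd l @ qs" "l = length ps" and "good i m" "I 0 i m"
  have P1: "l < length P" "P ! l = IJump_less a b (l + 2)"
    and P2: "Suc l < length P" "P ! Suc l = Jump ?l"
    and P3: "?r < length P" "P ! ?r = Jump l"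
    and P4: "P = (ps @ take 2 (while_less a b cd l)) @ cd (l + 2) @ (Jump l # qs)"
      "l + 2 = length (ps @ take 2 (while_less a b cd l))"
    using P by (auto simp: while_less_def nth_append)
  have jump: "cost w (Jump l') c \<le> C" for l' and c
    by (simp add: C_def)
  have jless: "cost w (IJump_less a b l') \<lparr>pc = l, ix = i, mem = m\<rparr> \<le> C"
    if "good i m" for l' i m
    using good_size(1)[OF that, of a] good_size(1)[OF that, of b] by (simp add: C_def)
  have "\<exists>i' m'. good i' m' \<and> I N i' m' \<and>
      runs P \<lparr>pc = l, ix = i, mem = m\<rparr> (?s k) \<lparr>pc = ?l, ix = i', mem = m'\<rparr>"
    if "k \<le> N" "good i m" "I k i m" for k i m
    using that
  \<comment> \<open>Downward induction on \<open>k\<close>, starting at \<open>N\<close>, where the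
    loop exits.\<close>
  proof (induction k arbitrary: i m rule: inc_induct)
    case base
    have "runs P \<lparr>pc = l, ix = i, mem = m\<rparr> C \<lparr>pc = Suc l, ix = i, mem = m\<rparr>"
      using test[of N i m] base by (intro runs_step[OF P1 _ jless]) simp_all
    moreover have "runs P \<lparr>pc = Suc l, ix = i, mem = m\<rparr> C \<lparr>pc = ?l, ix = i, mem = m\<rparr>"
      by (intro runs_step[OF P2 _ jump]) simp
    ultimately have "runs P \<lparr>pc = l, ix = i, mem = m\<rparr> (?s N) \<lparr>pc = ?l, ix = i, mem = m\<rparr>"
      by (rule runs_trans) simp
    then show ?case using base by blast
  next
    case (step k)
    obtain i1 m1 where 1: "good i1 m1" "I (Suc k) i1 m1"
      "runs P \<lparr>pc = l + 2, ix = i, mem = m\<rparr> t \<lparr>pc = ?r, ix = i1, mem = m1\<rparr>"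
      by (rule tripleE[OF body[OF step.hyps(2)], OF P4 step.prems])
    from step.IH[OF 1(1,2)] obtain i2 m2 where 2: "good i2 m2" "I N i2 m2"
      "runs P \<lparr>pc = l, ix = i1, mem = m1\<rparr> (?s (Suc k)) \<lparr>pc = ?l, ix = i2, mem = m2\<rparr>"
      by blast
    have "runs P \<lparr>pc = l, ix = i, mem = m\<rparr> C \<lparr>pc = l + 2, ix = i, mem = m\<rparr>"
      using test[of k i m] step by (intro runs_step[OF P1 _ jless]) simp_all
    from runs_trans[OF this 1(3) order.refl]
    have "runs P \<lparr>pc = l, ix = i, mem = m\<rparr> (C + t) \<lparr>pc = ?r, ix = i1, mem = m1\<rparr>" .
    moreover have "runs P \<lparr>pc = ?r, ix = i1, mem = m1\<rparr> C \<lparr>pc = l, ix = i1, mem = m1\<rparr>"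
      by (intro runs_step[OF P3 _ jump]) simp
    ultimately have "runs P \<lparr>pc = l, ix = i, mem = m\<rparr> (C + t + C) \<lparr>pc = l, ix = i1, mem = m1\<rparr>"
      by (rule runs_trans) simp
    moreover have "N - k = Suc (N - Suc k)" using step.hyps by simp
    then have "C + t + C + ?s (Suc k) \<le> ?s k" by (simp add: algebra_simps)
    ultimately show ?case using runs_trans[OF _ 2(3)] 2(1,2) by blast
  qed
  from this[of 0 i m] \<open>good i m\<close> \<open>I 0 i m\<close>
  show "\<exists>i' m'. good i' m' \<and> I N i' m' \<and>
      runs P \<lparr>pc = l, ix = i, mem = m\<rparr> (N * (t + 2 * C) + 2 * C)
        \<lparr>pc = ?l, ix = i', mem = m'\<rparr>"
    by simp
qed

text \<open>Placed at position 0 with nothing around it, the fragment ends where the program ends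
  and halts there at no further cost.\<close>

lemma triple_exec:
  assumes "triple Q cd t R" "good i m" "Q i m"
  obtains t' c' where "exec w (cd 0) \<lparr>pc = 0, ix = i, mem = m\<rparr> t' c'" "t' \<le> t" "R (ix c') (mem c')"
proof -
  have P: "cd 0 = [] @ cd 0 @ []" "0 = length ([] :: instr list)" by simp_all
  obtain i' m' where 1: "R i' m'"
    "runs (cd 0) \<lparr>pc = 0, ix = i, mem = m\<rparr> t \<lparr>pc = 0 + length (cd 0), ix = i', mem = m'\<rparr>"
    by (rule tripleE[OF assms(1), OF P assms(2,3)])
  let ?c = "\<lparr>pc = 0 + length (cd 0), ix = i', mem = m'\<rparr>"
  have "exec w (cd 0) ?c 0 ?c"
    by (rule exec.halt) simp
  with 1(2) obtain t' where "t' \<le> t" "exec w (cd 0) \<lparr>pc = 0, ix = i, mem = m\<rparr> (t' + 0) ?c"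
    unfolding runs_def by blast
  with 1(1) show ?thesis by (intro that[of "t' + 0" ?c]) simp_all
qed

end

section \<open>The program\<close>

text \<open>Index registers cannot multiply, so \<open>n * n\<close> is accumulated in register 3 by
  repeated addition.\<close>

definition ilcp_size_block :: code where
  "ilcp_size_block = (\<lambda>_. [IConst 2 1]) ;;
     while_less 9 0 (\<lambda>_. [IAdd 3 3 0, IAdd 9 9 2])"

text \<open>Adding register 10, which stays zero, copies a register. The loop adds the squares of
  the entries of \<open>x0\<close> to 1.\<close>

definition ilcp_setup_block :: code where
  "ilcp_setup_block =
     (\<lambda>_. [IAdd 4 3 0, IAdd 5 4 0, IAdd 6 5 0, IAdd 7 6 2, IAdd 8 7 2,
           RConst 8 1, IAdd 9 4 10]) ;;
     while_less 9 5 (\<lambda>_. [RArith Times 7 9 9, RArith Plus 8 8 7, IAdd 9 9 2]) ;;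
     (\<lambda>_. [IAdd 12 3 10, IAdd 13 5 10])"

text \<open>Register 14 scans the row so that register 11 stays at its beginning for the
  update.\<close>

definition ilcp_residual_block :: code where
  "ilcp_residual_block =
     (\<lambda>_. [RArith Minus 6 13 12, IAdd 9 4 10, IAdd 14 11 10]) ;;
     while_less 9 5
       (\<lambda>_. [RArith Times 7 14 9, RArith Minus 6 6 7, IAdd 9 9 2, IAdd 14 14 2]) ;;
     (\<lambda>_. [RArith Divide 6 6 8])"

text \<open>Register 11 itself runs through the row and thus ends at the start of the next
  one.\<close>

definition ilcp_update_block :: code where
  "ilcp_update_block =
     (\<lambda>_. [RArith Plus 12 12 6, IAdd 9 4 10]) ;;
     while_less 9 5
       (\<lambda>_. [RArith Times 7 6 9, RArith Plus 11 11 7, IAdd 9 9 2, IAdd 11 11 2]) ;;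
     (\<lambda>_. [IAdd 12 12 2, IAdd 13 13 2])"

text \<open>
  Register 2 holds the constant one, register 10 the constant zero. Registers 3, 4, 5 and 6 hold
  the addresses of \<open>q\<close>, \<open>x0\<close>, \<open>s0\<close> and of the first free cell, which accumulates the correction
  of a row; registers 7 and 8 hold the addresses of a temporary and of \<open>1 + x0 \<bullet> x0\<close>. Registers
  9, 11, 12, 13 and 14 run through \<open>x0\<close>, \<open>M\<close>, \<open>q\<close>, \<open>s0\<close> and the current row of \<open>M\<close>. The data
  \<open>M\<close> and \<open>q\<close> are overwritten by the solution.
\<close>

definition ilcp_code :: code where
  "ilcp_code = ilcp_size_block ;; ilcp_setup_block ;;
     while_less 12 4 (ilcp_residual_block ;; ilcp_update_block)"

section \<open>The computed values in terms of the initial memory\<close>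

locale ilcp_ram = real_size +
  fixes n S :: nat and m0 :: "nat \<Rightarrow> real"
  assumes B_data: "B (m0 a) S"
    and n_le: "n \<le> S"
begin

text \<open>\<open>m0\<close> is the initial memory and \<open>S\<close> stands for the input size.
  \<open>M\<close> fills the first \<open>n * n\<close> cells; \<open>q\<close>, \<open>x0\<close>
  and \<open>s0\<close> follow in blocks of length \<open>n\<close>.\<close>

definition den :: real where
  "den = 1 + (\<Sum>j<n. m0 (n * n + n + j) * m0 (n * n + n + j))"

definition rho :: "nat \<Rightarrow> real" where
  "rho k = (m0 (n * n + 2 * n + k) - m0 (n * n + k)
     - (\<Sum>j<n. m0 (k * n + j) * m0 (n * n + n + j))) / den"

definition sol :: "nat \<Rightarrow> real" where
  "sol a = (if a < n * n then m0 a + rho (a div n) * m0 (n * n + n + a mod n)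
            else m0 a + rho (a - n * n))"

text \<open>The largest address in use: three working cells follow the \<open>n * n + 3 * n\<close>
  cells of the input.\<close>

definition space :: nat where
  "space = n * n + 3 * n + 2"

text \<open>The exponent of an updated entry of \<open>M\<close>: \<open>2 * S + 2 * (S * S)\<close>
  from the numerator of \<open>rho\<close>, \<open>1 + 2 * (S * S)\<close> from its denominator, and
  \<open>S\<close> each from the factor and the summand.\<close>

definition bound :: nat where
  "bound = 4 * (S * S) + 4 * S + 1"

sublocale bounded_ram w B space bound ..

lemma le_space [simp]: "a \<le> space \<longleftrightarrow> a \<le> n * n + 3 * n + 2"
  by (simp add: space_def)

section \<open>Size bounds for the intermediate values\<close>

lemma bound_le: "B x k \<Longrightarrow> k \<le> 4 * (S * S) + 4 * S + 1 \<Longrightarrow> B x bound"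
  unfolding bound_def by (rule B_mono)

text \<open>Exponents add up along the sum: at most \<open>S\<close> products of exponent
  \<open>2 * S\<close> each. Prefixes are included because partial sums are stored.\<close>

lemma B_dot:
  assumes "k \<le> n"
  shows "B (\<Sum>j<k. m0 (f j) * m0 (g j)) (2 * (S * S))"
proof -
  have "B (\<Sum>j<k. m0 (f j) * m0 (g j)) (k * (S + S))"
    by (intro B_sum B_mult[OF B_data B_data]) simp
  moreover have "k * (S + S) \<le> S * (S + S)"
    using assms n_le by (intro mult_le_mono1) simp
  then have "k * (S + S) \<le> 2 * (S * S)" by (simp add: algebra_simps)
  ultimately show ?thesis by (rule B_mono)
qed

lemma B_den: "k \<le> n \<Longrightarrow> B (1 + (\<Sum>j<k. m0 (f j) * m0 (g j))) (1 + 2 * (S * S))"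
  by (intro B_add[OF B_one B_dot]) simp_all

lemma B_residual: "k \<le> n \<Longrightarrow> B (m0 a - m0 b - (\<Sum>j<k. m0 (f j) * m0 (g j))) (2 * S + 2 * (S * S))"
  by (rule B_diff[OF B_diff[OF B_data B_data order.refl] B_dot]) simp_all

lemma B_rho: "B (rho k) (2 * S + 4 * (S * S) + 1)"
  unfolding rho_def den_def by (rule B_divide[OF B_residual B_den]) simp_all

lemma one_bound: "B 1 bound"
  by (rule bound_le[OF B_one]) simp

lemma data_bound: "B (m0 a) bound"
  by (rule bound_le[OF B_data]) simp

lemma prod_bound: "B (m0 a * m0 b) bound"
  by (rule bound_le[OF B_mult[OF B_data B_data order.refl]]) simp

lemma den_bound: "k \<le> n \<Longrightarrow> B (1 + (\<Sum>j<k. m0 (f j) * m0 (g j))) bound"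
  by (rule bound_le[OF B_den]) simp_all

lemma residual_bound: "k \<le> n \<Longrightarrow> B (m0 a - m0 b - (\<Sum>j<k. m0 (f j) * m0 (g j))) bound"
  by (rule bound_le[OF B_residual]) simp_all

lemma rho_bound: "B (rho k) bound"
  by (rule bound_le[OF B_rho]) simp

lemma rho_prod_bound: "B (rho k * m0 b) bound"
  by (rule bound_le[OF B_mult[OF B_rho B_data order.refl]]) simp

lemma sol_matrix_bound: "B (m0 a + rho k * m0 b) bound"
  by (rule bound_le[OF B_add[OF B_data B_mult[OF B_rho B_data order.refl] order.refl]]) simp

lemma sol_vector_bound: "B (m0 a + rho k) bound"
  by (rule bound_le[OF B_add[OF B_data B_rho order.refl]]) simp

section \<open>Loop invariants and running times of the blocks\<close>

definition base :: "(nat \<Rightarrow> nat) \<Rightarrow> bool" where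
  "base i \<longleftrightarrow> i 0 = n \<and> i 2 = 1 \<and> i 3 = n * n \<and> i 4 = n * n + n \<and> i 5 = n * n + 2 * n \<and>
     i 6 = n * n + 3 * n \<and> i 7 = n * n + 3 * n + 1 \<and> i 8 = n * n + 3 * n + 2 \<and> i 10 = 0"

lemma baseD:
  assumes "base i"
  shows "i 0 = n" "i 2 = 1" "i 3 = n * n" "i 4 = n * n + n" "i 5 = n * n + 2 * n"
    "i 6 = n * n + 3 * n" "i 7 = n * n + 3 * n + 1" "i 8 = n * n + 3 * n + 2" "i 10 = 0"
  using assms by (auto simp: base_def)

lemma base_upd: "r \<notin> {0, 2, 3, 4, 5, 6, 7, 8, 10} \<Longrightarrow> base (i(r := v)) \<longleftrightarrow> base i"
  by (simp add: base_def)

text \<open>Progress of the in-place update: \<open>l\<close> counts the finished cells of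
  \<open>M\<close> and \<open>k\<close> the finished entries of \<open>q\<close>.\<close>

definition cells :: "nat \<Rightarrow> nat \<Rightarrow> (nat \<Rightarrow> real) \<Rightarrow> bool" where
  "cells k l m \<longleftrightarrow> (\<forall>a<n * n + 3 * n.
     m a = (if a < l \<or> n * n \<le> a \<and> a < n * n + k then sol a else m0 a))"

definition started :: assn where
  "started i m \<longleftrightarrow> (\<forall>r. i r = (if r = 0 then n else 0)) \<and> m = m0"

definition rows :: "nat \<Rightarrow> assn" where
  "rows k i m \<longleftrightarrow> base i \<and> i 11 = k * n \<and> i 12 = n * n + k \<and> i 13 = n * n + 2 * n + k \<and>
     cells k (k * n) m \<and> m (n * n + 3 * n + 2) = den"

lemma square_bound: "k \<le> n \<Longrightarrow> k * n \<le> n * n"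
  by simp

lemma row_bound: "k < n \<Longrightarrow> k * n + n \<le> n * n"
  using square_bound[of "Suc k"] by simp

text \<open>The cost factors of all blocks count instructions: the straight-line ones, per round the
  body and two jumps, and two more on leaving the loop.\<close>

lemma size_block:
  "triple started ilcp_size_block ((n * 4 + 3) * C)
     (\<lambda>i m. i 0 = n \<and> i 2 = 1 \<and> i 3 = n * n \<and> i 10 = 0 \<and> i 11 = 0 \<and> m = m0)"
proof -
  define I where "I k i m \<longleftrightarrow> i 0 = n \<and> i 2 = 1 \<and> i 3 = k * n \<and> i 9 = k \<and> i 10 = 0 \<and> i 11 = 0 \<and> m = m0"
    for k :: nat and i :: "nat \<Rightarrow> nat" and m :: "nat \<Rightarrow> real"
  have 1: "triple started (\<lambda>_. [IConst 2 1]) (length [IConst 2 1] * C) (I 0)"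
    by (rule triple_block) (simp add: started_def I_def)
  have 2: "triple (I 0) (while_less 9 0 (\<lambda>_. [IAdd 3 3 0, IAdd 9 9 2]))
      (n * (length [IAdd 3 3 0, IAdd 9 9 2] * C + 2 * C) + 2 * C) (I n)"
  proof (rule triple_while)
    fix k assume "k < n"
    then show "triple (I k) (\<lambda>_. [IAdd 3 3 0, IAdd 9 9 2])
        (length [IAdd 3 3 0, IAdd 9 9 2] * C) (I (Suc k))"
      using row_bound[of k] by (intro triple_block) (simp_all add: I_def)
  qed (simp_all add: I_def)
  show ?thesis
    unfolding ilcp_size_block_def
    by (rule triple_weaken[OF triple_seq[OF 1 2]]) (auto simp: I_def algebra_simps)
qed

lemma setup_block:
  "triple (\<lambda>i m. i 0 = n \<and> i 2 = 1 \<and> i 3 = n * n \<and> i 10 = 0 \<and> i 11 = 0 \<and> m = m0) ilcp_setup_block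
     ((n * 5 + 11) * C) (rows 0)"
proof -
  define I where "I k i m \<longleftrightarrow> base i \<and> i 9 = n * n + n + k \<and> i 11 = 0 \<and>
      (\<forall>a<n * n + 3 * n. m a = m0 a) \<and>
      m (n * n + 3 * n + 2) = 1 + (\<Sum>j<k. m0 (n * n + n + j) * m0 (n * n + n + j))"
    for k :: nat and i :: "nat \<Rightarrow> nat" and m :: "nat \<Rightarrow> real"
  let ?init = "[IAdd 4 3 0, IAdd 5 4 0, IAdd 6 5 0, IAdd 7 6 2, IAdd 8 7 2, RConst 8 1, IAdd 9 4 10]"
  let ?body = "[RArith Times 7 9 9, RArith Plus 8 8 7, IAdd 9 9 2]"
  let ?fin = "[IAdd 12 3 10, IAdd 13 5 10]"
  have 1: "triple (\<lambda>i m. i 0 = n \<and> i 2 = 1 \<and> i 3 = n * n \<and> i 10 = 0 \<and> i 11 = 0 \<and> m = m0) (\<lambda>_. ?init)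
      (length ?init * C) (I 0)"
    by (rule triple_block) (simp add: I_def base_def one_bound)
  have 2: "triple (I 0) (while_less 9 5 (\<lambda>_. ?body)) (n * (length ?body * C + 2 * C) + 2 * C) (I n)"
  proof (rule triple_while)
    fix k assume "k < n"
    then show "triple (I k) (\<lambda>_. ?body) (length ?body * C) (I (Suc k))"
      using den_bound[of "Suc k" "\<lambda>j. n * n + n + j" "\<lambda>j. n * n + n + j"]
      by (intro triple_block) (simp add: I_def baseD base_upd prod_bound add.assoc)
  qed (auto simp: I_def baseD)
  have 3: "triple (I n) (\<lambda>_. ?fin) (length ?fin * C) (rows 0)"
    by (rule triple_block) (auto simp: I_def rows_def baseD base_upd cells_def den_def)
  show ?thesis
    unfolding ilcp_setup_block_def
    by (rule triple_weaken[OF triple_seq[OF 1 triple_seq[OF 2 3]]]) (auto simp: algebra_simps)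
qed

definition row_done :: "nat \<Rightarrow> assn" where
  "row_done k i m \<longleftrightarrow> rows k i m \<and> m (n * n + 3 * n) = rho k"

text \<open>Only working cells are written, so \<open>rows k\<close> survives and the block reads
  the original row of \<open>M\<close> and entry of \<open>q\<close>.\<close>

lemma residual_block:
  assumes "k < n"
  shows "triple (rows k) ilcp_residual_block ((n * 6 + 6) * C) (row_done k)"
proof -
  define I where "I l i m \<longleftrightarrow> rows k i m \<and> i 9 = n * n + n + l \<and> i 14 = k * n + l \<and>
      m (n * n + 3 * n) = m0 (n * n + 2 * n + k) - m0 (n * n + k)
        - (\<Sum>j<l. m0 (k * n + j) * m0 (n * n + n + j))"
    for l :: nat and i :: "nat \<Rightarrow> nat" and m :: "nat \<Rightarrow> real"
  let ?init = "[RArith Minus 6 13 12, IAdd 9 4 10, IAdd 14 11 10]"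
  let ?body = "[RArith Times 7 14 9, RArith Minus 6 6 7, IAdd 9 9 2, IAdd 14 14 2]"
  let ?fin = "[RArith Divide 6 6 8]"
  note row_bound[OF assms]
  have 1: "triple (rows k) (\<lambda>_. ?init) (length ?init * C) (I 0)"
  proof (rule triple_block)
    fix i m assume "rows k i m"
    \<comment> \<open>With the empty sum, \<open>residual_bound\<close> covers the initial
      difference.\<close>
    then show "wp ?init (I 0) i m"
      using assms \<open>k * n + n \<le> n * n\<close> residual_bound[of 0 "n * n + 2 * n + k" "n * n + k"]
      by (auto simp: I_def rows_def baseD base_upd cells_def)
  qed
  have 2: "triple (I 0) (while_less 9 5 (\<lambda>_. ?body)) (n * (length ?body * C + 2 * C) + 2 * C) (I n)"
  proof (rule triple_while)
    fix l assume "l < n"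
    show "triple (I l) (\<lambda>_. ?body) (length ?body * C) (I (Suc l))"
    proof (rule triple_block)
      fix i m assume "I l i m"
      then show "wp ?body (I (Suc l)) i m"
        using assms \<open>l < n\<close> \<open>k * n + n \<le> n * n\<close>
          residual_bound[of "Suc l" "n * n + 2 * n + k" "n * n + k"
              "\<lambda>j. k * n + j" "\<lambda>j. n * n + n + j"]
        by (auto simp: I_def rows_def baseD base_upd cells_def prod_bound diff_diff_eq add.assoc)
    qed
  qed (auto simp: I_def rows_def baseD)
  have 3: "triple (I n) (\<lambda>_. ?fin) (length ?fin * C) (row_done k)"
  proof (rule triple_block)
    fix i m assume "I n i m"
    then show "wp ?fin (row_done k) i m"
      using rho_bound[of k]
      by (auto simp: I_def row_done_def rows_def baseD base_upd cells_def rho_def)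
  qed
  show ?thesis
    unfolding ilcp_residual_block_def
    by (rule triple_weaken[OF triple_seq[OF 1 triple_seq[OF 2 3]]]) (auto simp: algebra_simps)
qed

lemma sol_matrix:
  assumes "k < n" "l < n"
  shows "sol (k * n + l) = m0 (k * n + l) + rho k * m0 (n * n + n + l)"
  using assms row_bound[OF assms(1)] by (simp add: sol_def)

lemma sol_vector: "sol (n * n + k) = m0 (n * n + k) + rho k"
  by (simp add: sol_def)

text \<open>The entry of \<open>q\<close> is changed before the loop, hence
  \<open>cells (Suc k)\<close> already in the invariant. At the end \<open>k * n + n\<close> equals
  \<open>Suc k * n\<close>, as the next row requires.\<close>

lemma update_block:
  assumes "k < n"
  shows "triple (row_done k) ilcp_update_block ((n * 6 + 6) * C) (rows (Suc k))"
proof -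
  define I where "I l i m \<longleftrightarrow> base i \<and> i 9 = n * n + n + l \<and> i 11 = k * n + l \<and>
      i 12 = n * n + k \<and> i 13 = n * n + 2 * n + k \<and>
      cells (Suc k) (k * n + l) m \<and> m (n * n + 3 * n + 2) = den \<and> m (n * n + 3 * n) = rho k"
    for l :: nat and i :: "nat \<Rightarrow> nat" and m :: "nat \<Rightarrow> real"
  let ?init = "[RArith Plus 12 12 6, IAdd 9 4 10]"
  let ?body = "[RArith Times 7 6 9, RArith Plus 11 11 7, IAdd 9 9 2, IAdd 11 11 2]"
  let ?fin = "[IAdd 12 12 2, IAdd 13 13 2]"
  note row_bound[OF assms]
  have 1: "triple (row_done k) (\<lambda>_. ?init) (length ?init * C) (I 0)"
  proof (rule triple_block)
    fix i m assume "row_done k i m"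
    then show "wp ?init (I 0) i m"
      using assms \<open>k * n + n \<le> n * n\<close> sol_vector_bound
      by (auto simp: I_def row_done_def rows_def baseD base_upd cells_def sol_vector less_Suc_eq)
  qed
  have 2: "triple (I 0) (while_less 9 5 (\<lambda>_. ?body)) (n * (length ?body * C + 2 * C) + 2 * C) (I n)"
  proof (rule triple_while)
    fix l assume "l < n"
    show "triple (I l) (\<lambda>_. ?body) (length ?body * C) (I (Suc l))"
    proof (rule triple_block)
      fix i m assume "I l i m"
      then show "wp ?body (I (Suc l)) i m"
        using assms \<open>l < n\<close> \<open>k * n + n \<le> n * n\<close> sol_matrix_bound rho_prod_bound
        by (auto simp: I_def baseD base_upd cells_def sol_matrix less_Suc_eq)
    qed
  qed (auto simp: I_def baseD)
  have 3: "triple (I n) (\<lambda>_. ?fin) (length ?fin * C) (rows (Suc k))"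
  proof (rule triple_block)
    fix i m assume "I n i m"
    then show "wp ?fin (rows (Suc k)) i m"
      using assms by (auto simp: I_def rows_def baseD base_upd add.commute)
  qed
  show ?thesis
    unfolding ilcp_update_block_def
    by (rule triple_weaken[OF triple_seq[OF 1 triple_seq[OF 2 3]]]) (auto simp: algebra_simps)
qed

lemma ilcp_code_triple:
  "triple started ilcp_code ((12 * (n * n) + 23 * n + 16) * C) (rows n)"
proof -
  have "triple (rows 0) (while_less 12 4 (ilcp_residual_block ;; ilcp_update_block))
      (n * (((n * 6 + 6) * C + (n * 6 + 6) * C) + 2 * C) + 2 * C) (rows n)"
  proof (rule triple_while)
    fix k assume k: "k < n"
    show "triple (rows k) (ilcp_residual_block ;; ilcp_update_block)
        ((n * 6 + 6) * C + (n * 6 + 6) * C) (rows (Suc k))"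
      by (rule triple_seq[OF residual_block[OF k] update_block[OF k]])
  qed (auto simp: rows_def baseD)
  from triple_seq[OF size_block triple_seq[OF setup_block this]] show ?thesis
    unfolding ilcp_code_def by (rule triple_weaken) (auto simp: algebra_simps)
qed

lemma ilcp_code_exec:
  obtains t c where
    "exec w (ilcp_code 0) \<lparr>pc = 0, ix = (\<lambda>_. 0)(0 := n), mem = m0\<rparr> t c"
    "t \<le> (12 * (n * n) + 23 * n + 16) * C"
    "\<And>a. a < n * n + n \<Longrightarrow> mem c a = sol a"
proof -
  have good: "good ((\<lambda>_. 0)(0 := n)) m0"
    by (simp add: good_def data_bound)
  have started: "started ((\<lambda>_. 0)(0 := n)) m0"
    by (simp add: started_def)
  obtain t c where 1: "exec w (ilcp_code 0) \<lparr>pc = 0, ix = (\<lambda>_. 0)(0 := n), mem = m0\<rparr> t c"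
      "t \<le> (12 * (n * n) + 23 * n + 16) * C" "rows n (ix c) (mem c)"
    by (rule triple_exec[OF ilcp_code_triple, OF good started])
  show ?thesis
    by (rule that[OF 1(1,2)]) (use 1(3) in \<open>auto simp: rows_def cells_def\<close>)
qed

end

section \<open>Bit sizes of rational numbers\<close>

definition height :: "rat \<Rightarrow> nat" where
  "height r = nat \<bar>fst (quotient_of r)\<bar> + nat (snd (quotient_of r))"

text \<open>Cancelling only shrinks a fraction: the coprime numerator and denominator divide
  \<open>a\<close> and \<open>b\<close>.\<close>

lemma height_le:
  assumes "r = of_int a / of_int b" "b \<noteq> 0"
  shows "int (height r) \<le> \<bar>a\<bar> + \<bar>b\<bar>"
proof -
  obtain p q where pq: "quotient_of r = (p, q)" by force
  then have q: "q > 0" and cop: "coprime p q" and "r = of_int p / of_int q"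
    by (auto simp: quotient_of_denom_pos quotient_of_coprime quotient_of_div)
  with assms have "of_int (p * b) = (of_int (a * q) :: rat)"
    by (simp add: field_simps)
  then have eq: "p * b = a * q" by (simp only: of_int_eq_iff)
  have "q dvd p * b" by (simp add: eq)
  then have "q dvd b"
    using cop by (simp add: coprime_dvd_mult_right_iff coprime_commute)
  then have "q \<le> \<bar>b\<bar>" using dvd_imp_le_int[OF assms(2), of q] by simp
  moreover have "p dvd a * q" by (simp flip: eq)
  then have "p dvd a"
    using cop by (simp add: coprime_dvd_mult_left_iff)
  \<comment> \<open>For \<open>a = 0\<close> divisibility bounds nothing, but then
    \<open>p * b = 0\<close> forces \<open>p = 0\<close>.\<close>
  then have "\<bar>p\<bar> \<le> \<bar>a\<bar>"
    using dvd_imp_le_int[of a p] eq assms(2) by (cases "a = 0") auto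
  ultimately show ?thesis using q by (simp add: height_def pq)
qed

lemma height_quotient:
  obtains a b where "r = of_int a / of_int b" "b > 0" "int (height r) = \<bar>a\<bar> + b"
proof -
  obtain a b where "quotient_of r = (a, b)" by force
  then show ?thesis
    using that[of a b] quotient_of_denom_pos[of r a b] by (simp add: height_def quotient_of_div)
qed

text \<open>The product of the heights expands into four nonnegative terms, and each result has a
  representation whose numerator and denominator are bounded by disjoint groups of these
  terms.\<close>

lemma height_ops:
  shows "height (x + y) \<le> height x * height y" "height (x - y) \<le> height x * height y"
    "height (x * y) \<le> height x * height y" "height (x / y) \<le> height x * height y"
proof -
  obtain a b where x: "x = of_int a / of_int b" "b > 0" "int (height x) = \<bar>a\<bar> + b"
    by (rule height_quotient)
  obtain c d where y: "y = of_int c / of_int d" "d > 0" "int (height y) = \<bar>c\<bar> + d"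
    by (rule height_quotient)
  have xy: "int (height x * height y) = \<bar>a\<bar> * \<bar>c\<bar> + \<bar>a\<bar> * d + b * \<bar>c\<bar> + b * d"
    using x(3) y(3) by (simp add: algebra_simps)
  have nonneg: "\<bar>a\<bar> * \<bar>c\<bar> \<ge> 0" "\<bar>a\<bar> * d \<ge> 0" "b * \<bar>c\<bar> \<ge> 0" "b * d \<ge> 0"
    using x(2) y(2) by auto
  have abs: "\<bar>a * d\<bar> = \<bar>a\<bar> * d" "\<bar>b * c\<bar> = b * \<bar>c\<bar>" "\<bar>b * d\<bar> = b * d" "\<bar>a * c\<bar> = \<bar>a\<bar> * \<bar>c\<bar>"
    using x(2) y(2) by (auto simp: abs_mult)
  have bd: "b * d \<noteq> 0" using x(2) y(2) by simp
  have "x + y = of_int (a * d + b * c) / of_int (b * d)"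
    unfolding x(1) y(1) using x(2) y(2) by (simp add: field_simps)
  from height_le[OF this bd] have "int (height (x + y)) \<le> int (height x * height y)"
    using xy nonneg abs abs_triangle_ineq[of "a * d" "b * c"] by linarith
  then show "height (x + y) \<le> height x * height y" by (simp only: of_nat_le_iff)
  have "x - y = of_int (a * d - b * c) / of_int (b * d)"
    unfolding x(1) y(1) using x(2) y(2) by (simp add: field_simps)
  from height_le[OF this bd] have "int (height (x - y)) \<le> int (height x * height y)"
    using xy nonneg abs abs_triangle_ineq4[of "a * d" "b * c"] by linarith
  then show "height (x - y) \<le> height x * height y" by (simp only: of_nat_le_iff)
  have "x * y = of_int (a * c) / of_int (b * d)"
    unfolding x(1) y(1) using x(2) y(2) by (simp add: field_simps)
  from height_le[OF this bd] have "int (height (x * y)) \<le> int (height x * height y)"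
    using xy nonneg abs by linarith
  then show "height (x * y) \<le> height x * height y" by (simp only: of_nat_le_iff)
  show "height (x / y) \<le> height x * height y"
  \<comment> \<open>Division by zero gives \<open>0 / 1\<close>, which has height 1.\<close>
  proof (cases "c = 0")
    case True
    then have "height (x / y) = 1" using y by (simp add: height_def)
    moreover have "height x > 0" "height y > 0" using x(2,3) y(2,3) by linarith+
    ultimately show ?thesis by simp
  next
    case False
    then have bc: "b * c \<noteq> 0" using x(2) by simp
    have "x / y = of_int (a * d) / of_int (b * c)"
      unfolding x(1) y(1) using x(2) y(2) by (simp add: field_simps)
    from height_le[OF this bc] have "int (height (x / y)) \<le> int (height x * height y)"
      using xy nonneg abs by linarith
    then show ?thesis by (simp only: of_nat_le_iff)
  qed
qed

text \<open>Passing to exponents of 2 turns submultiplicativity of the height into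
  additivity.\<close>

definition height_bound :: "real \<Rightarrow> nat \<Rightarrow> bool" where
  "height_bound x k \<longleftrightarrow> (\<exists>r. x = of_rat r \<and> height r \<le> 2 ^ k)"

lemma bit_size_of_rat:
  "bit_size (of_rat r) =
     floorlog 2 (nat \<bar>fst (quotient_of r)\<bar>) + floorlog 2 (nat (snd (quotient_of r))) + 2"
proof -
  have "the_inv real_of_rat (of_rat r) = r"
    by (rule the_inv_f_f) (simp add: inj_on_def)
  then show ?thesis
    by (simp add: bit_size_def nat_size_def split: prod.split)
qed

lemma less_two_power_floorlog: "a < 2 ^ floorlog 2 a"
  using floorlog_leD[of 2 a "floorlog 2 a"] by simp

text \<open>The factor 2 from adding numerator and denominator is absorbed by the two extra bits
  counted in \<open>bit_size\<close>.\<close>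

lemma height_bound_bit_size:
  assumes "x \<in> \<rat>"
  shows "height_bound x (bit_size x)"
proof -
  from assms obtain r where r: "x = of_rat r" by (auto elim: Rats_cases)
  define a b where "a = nat \<bar>fst (quotient_of r)\<bar>" and "b = nat (snd (quotient_of r))"
  have "(2::nat) ^ floorlog 2 a \<le> 2 ^ (floorlog 2 a + floorlog 2 b)"
    "(2::nat) ^ floorlog 2 b \<le> 2 ^ (floorlog 2 a + floorlog 2 b)"
    by (rule power_increasing; simp)+
  then have "a + b \<le> 2 * 2 ^ (floorlog 2 a + floorlog 2 b)"
    using less_two_power_floorlog[of a] less_two_power_floorlog[of b] by linarith
  also have "\<dots> \<le> 2 ^ (floorlog 2 a + floorlog 2 b + 2)" by simp
  finally show ?thesis
    unfolding height_bound_def r bit_size_of_rat by (auto simp: height_def a_def b_def)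
qed

interpretation rational: real_size bit_size height_bound
proof
  fix x y :: real and k l :: nat and f
  show "height_bound x l" if x: "height_bound x k" and kl: "k \<le> l"
  proof -
    obtain r where "x = of_rat r" "height r \<le> 2 ^ k"
      using x unfolding height_bound_def by blast
    moreover have "(2 :: nat) ^ k \<le> 2 ^ l" using kl by simp
    ultimately show ?thesis unfolding height_bound_def using order_trans by blast
  qed
  show "height_bound (arith f x y) (k + l)" if x: "height_bound x k" and y: "height_bound y l"
  proof -
    obtain r s where rs: "x = of_rat r" "y = of_rat s" "height r \<le> 2 ^ k" "height s \<le> 2 ^ l"
      using x y unfolding height_bound_def by blast
    then have "height r * height s \<le> 2 ^ (k + l)"
      unfolding power_add by (intro mult_le_mono)
    then show ?thesis
      using height_ops[where x = r and y = s] rs(1,2) unfolding height_bound_def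
      by (cases f) (auto simp flip: of_rat_add of_rat_diff of_rat_mult of_rat_divide
          intro: order_trans)
  qed
  \<comment> \<open>Zero is \<open>0 / 1\<close> of height 1, and one is \<open>1 / 1\<close> of
    height 2.\<close>
  show "height_bound 0 0"
    unfolding height_bound_def by (intro exI[of _ 0]) (simp add: height_def)
  show "height_bound 1 1"
    unfolding height_bound_def by (intro exI[of _ 1]) (simp add: height_def)
  show "bit_size x \<le> 2 * k + 4" if "height_bound x k"
  proof -
    obtain r where r: "x = of_rat r" "height r \<le> 2 ^ k"
      using \<open>height_bound x k\<close> unfolding height_bound_def by blast
    \<comment> \<open>Numerator and denominator have at most \<open>k + 1\<close> bits each; with
      the two extra bits this gives \<open>2 * k + 4\<close>.\<close>
    have "floorlog 2 a \<le> k + 1" if "a \<le> height r" for a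
      using that r(2) by (intro floorlog_leI) (auto simp: le_less_trans)
    from this[of "nat \<bar>fst (quotient_of r)\<bar>"] this[of "nat (snd (quotient_of r))"]
    show ?thesis by (simp add: r(1) bit_size_of_rat height_def)
  qed
  show "0 < bit_size x"
    by (simp add: bit_size_def nat_size_def split: prod.split)
qed

interpretation unit: real_size "\<lambda>_. 1" "\<lambda>_ _. True"
  by unfold_locales auto

section \<open>The optimal solution\<close>

lemma ilcp_b_instancesE:
  assumes "(M, q, x, s) \<in> ilcp_b_instances"
  obtains n where "M \<in> carrier_mat n n" "q \<in> carrier_vec n" "x \<in> carrier_vec n" "s \<in> carrier_vec n"
    "x \<bullet> s = 0"
proof -
  have "\<exists>n. M \<in> carrier_mat n n \<and> q \<in> carrier_vec n \<and> x \<in> carrier_vec n \<and> s \<in> carrier_vec n \<and>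
     0\<^sub>v n \<le> x \<and> 0\<^sub>v n \<le> s \<and> x \<bullet> s = 0"
    using assms unfolding ilcp_b_instances_def mem_Collect_eq prod.case .
  then show ?thesis using that by (elim exE conjE)
qed

text \<open>Squaring removes the roots, and grouping by rows of \<open>(M, q)\<close> allows each
  row to be minimized separately.\<close>

lemma ilcp_b_objective_eq:
  assumes "M \<in> carrier_mat n n" "q \<in> carrier_vec n" "M' \<in> carrier_mat n n" "q' \<in> carrier_vec n"
  shows "ilcp_b_objective (M, q, x, s) (M', q') =
    (\<Sum>i<n. (\<Sum>j<n. (M' $$ (i, j) - M $$ (i, j))\<^sup>2) + (q' $ i - q $ i)\<^sup>2)"
proof -
  have "(frobenius_norm (M - M'))\<^sup>2 = (\<Sum>i<n. \<Sum>j<n. (M' $$ (i, j) - M $$ (i, j))\<^sup>2)"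
    using assms by (simp add: frobenius_norm_def sum_nonneg power2_commute)
  moreover have "(euclidean_norm (q - q'))\<^sup>2 = (\<Sum>i<n. (q' $ i - q $ i)\<^sup>2)"
    using assms by (simp add: euclidean_norm_def scalar_prod_def sum_nonneg atLeast0LessThan
        power2_commute flip: power2_eq_square)
  ultimately show ?thesis by (simp add: sum.distrib)
qed

lemma ilcp_b_feasible_iff:
  assumes "q \<in> carrier_vec n" "x \<in> carrier_vec n" "s \<in> carrier_vec n" "x \<bullet> s = 0"
  shows "ilcp_b_feasible (M, q, x, s) (M', q') \<longleftrightarrow>
    M' \<in> carrier_mat n n \<and> q' \<in> carrier_vec n \<and>
    (\<forall>i<n. s $ i = (\<Sum>j<n. M' $$ (i, j) * x $ j) + q' $ i)"
proof -
  have "s = M' *\<^sub>v x + q' \<longleftrightarrow> (\<forall>i<n. s $ i = (\<Sum>j<n. M' $$ (i, j) * x $ j) + q' $ i)"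
    if "M' \<in> carrier_mat n n" "q' \<in> carrier_vec n"
    using that assms(2,3) by (auto simp: vec_eq_iff scalar_prod_def atLeast0LessThan)
  then show ?thesis using assms by auto
qed

text \<open>Put \<open>d = (c, e)\<close> and \<open>v = (x, 1)\<close>. The hypothesis makes
  \<open>\<rho> v\<close> the orthogonal projection of \<open>d\<close> onto the line through
  \<open>v\<close>, and a projection is no longer than \<open>d\<close>: expand the squared length
  of \<open>d - \<rho> v\<close>.\<close>

lemma hyperplane_projection:
  fixes x c :: "nat \<Rightarrow> real"
  assumes "\<rho> * (1 + (\<Sum>j<n. x j * x j)) = (\<Sum>j<n. c j * x j) + e"
  shows "(\<Sum>j<n. (\<rho> * x j)\<^sup>2) + \<rho>\<^sup>2 \<le> (\<Sum>j<n. (c j)\<^sup>2) + e\<^sup>2"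
proof -
  have "0 \<le> (\<Sum>j<n. (c j - \<rho> * x j)\<^sup>2) + (e - \<rho>)\<^sup>2"
    by (simp add: sum_nonneg)
  \<comment> \<open>The nesting of the quadratic term exposes the left-hand side of the hypothesis
    for the next rewriting.\<close>
  also have "\<dots> = (\<Sum>j<n. (c j)\<^sup>2) + e\<^sup>2 + \<rho> * (\<rho> * (1 + (\<Sum>j<n. x j * x j)))
      - 2 * \<rho> * ((\<Sum>j<n. c j * x j) + e)"
    by (simp add: power2_eq_square algebra_simps sum.distrib sum_subtractf sum_distrib_left)
  also have "\<dots> = (\<Sum>j<n. (c j)\<^sup>2) + e\<^sup>2 - \<rho> * (\<rho> * (1 + (\<Sum>j<n. x j * x j)))"
    by (simp add: assms)
  also have "\<dots> = (\<Sum>j<n. (c j)\<^sup>2) + e\<^sup>2 - ((\<Sum>j<n. (\<rho> * x j)\<^sup>2) + \<rho>\<^sup>2)"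
    by (simp add: power2_eq_square algebra_simps sum_distrib_left)
  finally show ?thesis by simp
qed

text \<open>The correction removes the defect of each row exactly. Every feasible competitor removes
  the same defect, so its deviation from the data projects onto this correction.\<close>

lemma ilcp_b_optimal_correction:
  assumes "M \<in> carrier_mat n n" "q \<in> carrier_vec n" "x \<in> carrier_vec n" "s \<in> carrier_vec n"
    and "x \<bullet> s = 0"
    and \<rho>: "\<And>i. i < n \<Longrightarrow> \<rho> i * (1 + (\<Sum>j<n. x $ j * x $ j)) =
        s $ i - q $ i - (\<Sum>j<n. M $$ (i, j) * x $ j)"
  shows "ilcp_b_optimal (M, q, x, s)
    (mat n n (\<lambda>(i, j). M $$ (i, j) + \<rho> i * x $ j), vec n (\<lambda>i. q $ i + \<rho> i))"
    (is "ilcp_b_optimal ?I (?M, ?q)")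
  unfolding ilcp_b_optimal_def is_arg_min_def
proof (intro conjI notI)
  note feasible = ilcp_b_feasible_iff[OF assms(2-5)]
  have "s $ i = (\<Sum>j<n. (M $$ (i, j) + \<rho> i * x $ j) * x $ j) + (q $ i + \<rho> i)" if "i < n" for i
    using \<rho>[OF that] by (simp add: algebra_simps sum.distrib sum_distrib_left)
  then show "ilcp_b_feasible ?I (?M, ?q)"
    unfolding feasible by simp
  assume "\<exists>y. ilcp_b_feasible ?I y \<and> ilcp_b_objective ?I y < ilcp_b_objective ?I (?M, ?q)"
  then obtain M' q' where feas: "ilcp_b_feasible ?I (M', q')"
    and less: "ilcp_b_objective ?I (M', q') < ilcp_b_objective ?I (?M, ?q)"
    by auto
  have M': "M' \<in> carrier_mat n n" "q' \<in> carrier_vec n"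
    and s: "\<And>i. i < n \<Longrightarrow> s $ i = (\<Sum>j<n. M' $$ (i, j) * x $ j) + q' $ i"
    using feas unfolding feasible by blast+
  have "ilcp_b_objective ?I (?M, ?q) = (\<Sum>i<n. (\<Sum>j<n. (\<rho> i * x $ j)\<^sup>2) + (\<rho> i)\<^sup>2)"
    using assms by (subst ilcp_b_objective_eq[of _ n]) auto
  \<comment> \<open>In row \<open>i\<close>, \<open>c\<close> and \<open>e\<close> are the
    competitor's deviations from \<open>M\<close> and \<open>q\<close>; subtracting the data from
    its constraint yields the hypothesis of the projection lemma.\<close>
  also have "\<dots> \<le> (\<Sum>i<n. (\<Sum>j<n. (M' $$ (i, j) - M $$ (i, j))\<^sup>2) + (q' $ i - q $ i)\<^sup>2)"
    by (intro sum_mono hyperplane_projection)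
      (use \<rho> s in \<open>simp add: algebra_simps sum_subtractf\<close>)
  also have "\<dots> = ilcp_b_objective ?I (M', q')"
    using assms M' by (subst ilcp_b_objective_eq[of _ n]) auto
  finally show False using less by simp
qed

section \<open>Memory layout\<close>

lemma concat_rows:
  "concat (map (\<lambda>i. map (f i) [0..<n]) [0..<k]) = map (\<lambda>a. f (a div n) (a mod n)) [0..<k * n]"
proof (induction k)
  case (Suc k)
  have "[0..<Suc k * n] = [0..<k * n] @ map (\<lambda>j. j + k * n) [0..<n]"
    using upt_add_eq_append[of 0 "k * n" n] by (simp add: map_add_upt add.commute)
  \<comment> \<open>For \<open>n = 0\<close> all rows are empty; otherwise \<open>j + k * n\<close>
    decodes to row \<open>k\<close> and column \<open>j\<close>.\<close>
  with Suc show ?case by (cases "n = 0") auto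
qed simp

lemma concat_mat_to_list:
  assumes "M \<in> carrier_mat n n"
  shows "concat (mat_to_list M) = map (\<lambda>a. M $$ (a div n, a mod n)) [0..<n * n]"
  using assms concat_rows[of "\<lambda>i j. M $$ (i, j)" n n] by (simp add: mat_to_list_def)

lemma length_ilcp_b_input:
  assumes "M \<in> carrier_mat n n" "q \<in> carrier_vec n" "x \<in> carrier_vec n" "s \<in> carrier_vec n"
  shows "length (snd (ilcp_b_input (M, q, x, s))) = n * n + 3 * n"
  using assms by (simp add: concat_mat_to_list)

lemma nth_ilcp_b_input:
  assumes "M \<in> carrier_mat n n" "q \<in> carrier_vec n" "x \<in> carrier_vec n" "s \<in> carrier_vec n"
    and "i < n"
  shows "j < n \<Longrightarrow> snd (ilcp_b_input (M, q, x, s)) ! (i * n + j) = M $$ (i, j)"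
    and "snd (ilcp_b_input (M, q, x, s)) ! (n * n + i) = q $ i"
    and "snd (ilcp_b_input (M, q, x, s)) ! (n * n + n + i) = x $ i"
    and "snd (ilcp_b_input (M, q, x, s)) ! (n * n + 2 * n + i) = s $ i"
proof -
  have "i * n + j < n * n" if "j < n"
    using that mult_le_mono1[of "Suc i" n n] assms(5) by simp
  then show "j < n \<Longrightarrow> snd (ilcp_b_input (M, q, x, s)) ! (i * n + j) = M $$ (i, j)"
    using assms by (simp add: concat_mat_to_list nth_append)
qed (use assms in \<open>simp_all add: concat_mat_to_list nth_append\<close>)

text \<open>\<open>f\<close> is an abstract memory in the output layout, later taken to be
  \<open>sol\<close>.\<close>

lemma nth_ilcp_b_output:
  assumes "\<And>i j. i < n \<Longrightarrow> j < n \<Longrightarrow> f (i * n + j) = A (i, j)"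
    and "\<And>i. i < n \<Longrightarrow> f (n * n + i) = b i"
    and "a < length (ilcp_b_output (mat n n A, vec n b))"
  shows "a < n * n + n" "ilcp_b_output (mat n n A, vec n b) ! a = f a"
proof -
  show a: "a < n * n + n"
    using assms(3) by (simp add: concat_mat_to_list[of _ n])
  show "ilcp_b_output (mat n n A, vec n b) ! a = f a"
  proof (cases "a < n * n")
    case True
    then have "a div n < n" "a mod n < n"
      by (auto simp: less_mult_imp_div_less intro!: mod_less_divisor gr0I)
    with assms(1)[of "a div n" "a mod n"] True show ?thesis
      by (simp add: concat_mat_to_list[of _ n] nth_append)
  next
    case False
    with assms(2)[of "a - n * n"] a show ?thesis
      by (simp add: concat_mat_to_list[of _ n] nth_append)
  qed
qed

section \<open>Polynomial running time\<close>

text \<open>This bounds the number of entries, and with it the square of the dimension, by the input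
  size.\<close>

lemma length_le_sum_list:
  fixes f :: "'a \<Rightarrow> nat"
  assumes "\<And>x. 0 < f x"
  shows "length xs \<le> (\<Sum>x\<leftarrow>xs. f x)"
proof (induction xs)
  case (Cons x xs)
  with assms[of x] show ?case by simp
qed simp

text \<open>One analysis serves both cost models; all they must provide is that each entry is
  bounded by its own size.\<close>

lemma (in real_size) poly_time_solvable_ilcp_b:
  assumes "I \<subseteq> ilcp_b_instances"
    and data: "\<And>inst x. inst \<in> I \<Longrightarrow> x \<in> set (snd (ilcp_b_input inst)) \<Longrightarrow> B x (w x)"
  shows "poly_time_solvable w I ilcp_b_optimal ilcp_b_input ilcp_b_output"
  unfolding poly_time_solvable_def
\<comment> \<open>With \<open>n * n + 3 * n \<le> S\<close>, the first factor bounds the number of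
  instructions \<open>12 * (n * n) + 23 * n + 16\<close> and the second the cost \<open>C\<close> of
  each.\<close>
proof (rule exI[of _ "ilcp_code 0"], rule exI[of _ "[:16, 12:] * [:22, 19, 16:]"], rule ballI)
  let ?p = "[:16, 12:] * [:22, 19, 16:] :: nat poly"
  fix inst assume inst: "inst \<in> I"
  obtain M q x s where inst_eq: "inst = (M, q, x, s)"
    by (rule prod_cases4)
  have "(M, q, x, s) \<in> ilcp_b_instances"
    using subsetD[OF assms(1) inst] unfolding inst_eq .
  then obtain n where carrier:
      "M \<in> carrier_mat n n" "q \<in> carrier_vec n" "x \<in> carrier_vec n" "s \<in> carrier_vec n"
    and compl: "x \<bullet> s = 0"
    by (rule ilcp_b_instancesE)
  define xs where "xs = snd (ilcp_b_input (M, q, x, s))"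
  define S where "S = input_size w (ilcp_b_input (M, q, x, s))"
  define m0 where "m0 a = (if a < length xs then xs ! a else 0)" for a
  note nth_xs = nth_ilcp_b_input[OF carrier, folded xs_def]
  have input: "ilcp_b_input (M, q, x, s) = (n, xs)"
    using carrier by (simp add: xs_def)
  have len: "length xs = n * n + 3 * n"
    unfolding xs_def by (rule length_ilcp_b_input[OF carrier])
  have S: "S = nat_size n + (\<Sum>x\<leftarrow>xs. w x)"
    unfolding S_def input by simp
  have n: "n * n + 3 * n \<le> S"
    using length_le_sum_list[of w xs] w_pos by (simp add: S len)
  have "B (m0 a) S" for a
  proof (cases "a < length xs")
    case True
    then have mem: "xs ! a \<in> set xs" by simp
    then have "B (xs ! a) (w (xs ! a))"
      unfolding xs_def by (rule data[OF inst, unfolded inst_eq])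
    moreover have "w (xs ! a) \<le> (\<Sum>x\<leftarrow>xs. w x)"
      using mem by (intro member_le_sum_list) auto
    then have "w (xs ! a) \<le> S" by (simp add: S)
    ultimately have "B (xs ! a) S" by (rule B_mono)
    with True show ?thesis by (simp add: m0_def)
  next
    case False
    then show ?thesis using B_mono[OF B_zero] by (simp add: m0_def)
  qed
  then interpret ilcp_ram w B n S m0
    using n by unfold_locales auto
  have m0_M: "m0 (i * n + j) = M $$ (i, j)" if "i < n" "j < n" for i j
    using nth_xs(1)[OF that] row_bound[OF that(1)] that by (simp add: m0_def len)
  have m0_vec: "m0 (n * n + i) = q $ i" "m0 (n * n + n + i) = x $ i" "m0 (n * n + 2 * n + i) = s $ i"
    if "i < n" for i
    using nth_xs(2-4)[OF that] that by (simp_all add: m0_def len)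
  have den: "den = 1 + (\<Sum>j<n. x $ j * x $ j)"
    by (simp add: den_def m0_vec)
  \<comment> \<open>The denominator is at least 1, so the division in \<open>rho\<close> is a
    genuine one.\<close>
  have "0 \<le> (\<Sum>j<n. x $ j * x $ j)" by (simp add: sum_nonneg)
  then have "den \<noteq> 0" by (simp add: den)
  then have rho: "rho i * (1 + (\<Sum>j<n. x $ j * x $ j)) =
      s $ i - q $ i - (\<Sum>j<n. M $$ (i, j) * x $ j)" if "i < n" for i
    using that by (simp add: rho_def m0_vec m0_M flip: den)
  let ?out = "(mat n n (\<lambda>(i, j). M $$ (i, j) + rho i * x $ j), vec n (\<lambda>i. q $ i + rho i))"
  obtain t c where run: "exec w (ilcp_code 0) \<lparr>pc = 0, ix = (\<lambda>_. 0)(0 := n), mem = m0\<rparr> t c"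
    "t \<le> (12 * (n * n) + 23 * n + 16) * C" "\<And>a. a < n * n + n \<Longrightarrow> mem c a = sol a"
    using ilcp_code_exec by blast
  have init: "init_state (ilcp_b_input (M, q, x, s)) = \<lparr>pc = 0, ix = (\<lambda>_. 0)(0 := n), mem = m0\<rparr>"
    unfolding input by (simp add: m0_def[abs_def])
  have "C \<le> 22 + 19 * S + 16 * (S * S)"
    unfolding C_def unfolding space_def bound_def using n by (simp add: algebra_simps)
  then have "(12 * (n * n) + 23 * n + 16) * C \<le> (16 + 12 * S) * (22 + 19 * S + 16 * (S * S))"
    using n by (intro mult_le_mono) simp_all
  also have "\<dots> = poly ?p S"
    by (simp add: algebra_simps)
  finally have time: "t \<le> poly ?p S" using run(2) by simp
  have result: "mem c a = ilcp_b_output ?out ! a" if "a < length (ilcp_b_output ?out)" for a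
  proof -
    note nth_out = nth_ilcp_b_output[OF _ _ that, of sol]
    have "a < n * n + n"
      by (rule nth_out(1)) (simp_all add: sol_matrix sol_vector m0_M m0_vec)
    moreover have "ilcp_b_output ?out ! a = sol a"
      by (rule nth_out(2)) (simp_all add: sol_matrix sol_vector m0_M m0_vec)
    ultimately show ?thesis using run(3) by simp
  qed
  show "\<exists>t c' out. exec w (ilcp_code 0) (init_state (ilcp_b_input inst)) t c' \<and>
      t \<le> poly ?p (input_size w (ilcp_b_input inst)) \<and> ilcp_b_optimal inst out \<and>
      (\<forall>k<length (ilcp_b_output out). mem c' k = ilcp_b_output out ! k)"
    unfolding inst_eq init S_def[symmetric]
    by (rule exI[of _ t], rule exI[of _ c], rule exI[of _ ?out])
      (intro conjI allI impI run(1) time result ilcp_b_optimal_correction[OF carrier compl rho])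
qed

theorem theorem3p2:
  shows "poly_time_solvable (\<lambda>_. 1) ilcp_b_instances
           ilcp_b_optimal ilcp_b_input ilcp_b_output \<and>
         poly_time_solvable bit_size rational_ilcp_b_instances
           ilcp_b_optimal ilcp_b_input ilcp_b_output"
proof
  show "poly_time_solvable (\<lambda>_. 1) ilcp_b_instances ilcp_b_optimal ilcp_b_input ilcp_b_output"
    by (rule unit.poly_time_solvable_ilcp_b) simp_all
  \<comment> \<open>Rationality of the data enters only here, through the height bound by the bit
    size.\<close>
  show "poly_time_solvable bit_size rational_ilcp_b_instances
      ilcp_b_optimal ilcp_b_input ilcp_b_output"
    by (rule rational.poly_time_solvable_ilcp_b)
      (auto simp: rational_ilcp_b_instances_def intro: height_bound_bit_size)
qed

end
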